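(* Let $d_1,d_2,d_3>0$ and $\theta\in\mathbb{R}$, and let $f,g,h$ be real-valued continuous functions on $[0,\infty)\times[0,\infty)\times[0,\infty)$ satisfying hypotheses [A1], [A2], [A3], [A4] listed in the context, with the associated constants $u^\ast,v^\ast,w^\ast>0$, $u_i,v_i,w_i>0$ $(i=1,2,3)$, and $\bar u>\underline{u}>0$, $\bar v>\underline{v}>0$, $\bar w>\underline{w}>0$. Let $\mathbf{e}_-$ and $\mathbf{e}_+$ each be one of the points $(0,0,0)$, $(u_1,0,0)$, $(0,v_2,0)$, $(0,0,w_3)$, $(u^\ast,v^\ast,w^\ast)$. Suppose that $(u(x),v(x),w(x))$, with $u(x),v(x),w(x)>0$ for all $x\in\mathbb{R}$, is a positive solution of the boundary value problem $$ \begin{cases} d_1\,u_{xx}+\theta\,u_{x}+u\,f(u,v,w)=0, & x\in\mathbb{R},\\ d_2\,v_{xx}+\theta\,v_{x}+v\,g(u,v,w)=0, & x\in\mathbb{R},\\ d_3\,w_{xx}+\theta\,w_{x}+w\,h(u,v,w)=0, & x\in\mathbb{R},\\ (u,v,w)(-\infty)=\mathbf{e}_{-},\quad (u,v,w)(+\infty)=\mathbf{e}_{+}. \end{cases} $$ Then for any $\alpha,\beta,\gamma>0$, the function $p(x)=\alpha\,u(x)+\beta\,v(x)+\gamma\,w(x)$ satisfies $$ \min(\alpha\,\underline{u},\beta\,\underline{v},\gamma\,\underline{w})\,\frac{\min(d_1,d_2,d_3)}{\max(d_1,d_2,d_3)}\,\chi\;\le\; p(x)\;\le\;\max(\alpha\,\bar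 u,\beta\,\bar v,\gamma\,\bar w)\,\frac{\max(d_1,d_2,d_3)}{\min(d_1,d_2,d_3)} $$ for all $x\in\mathbb{R}$, where $\chi=1$ if both $\mathbf{e}_-\neq(0,0,0)$ and $\mathbf{e}_+\neq(0,0,0)$, while $\chi=0$ if $\mathbf{e}_-=(0,0,0)$ or $\mathbf{e}_+=(0,0,0)$.
   Context: The values $(u,v,w)(\pm\infty)$ denote the limits of $(u(x),v(x),w(x))$ as $x\to\pm\infty$; solutions are classical (twice differentiable functions on $\mathbb{R}$). The hypotheses on $f,g,h$ are: [A1] (Unique coexistence state) $(u,v,w)=(u^\ast,v^\ast,w^\ast)$ is the unique solution with $u,v,w>0$ of the system $f(u,v,w)=0$, $g(u,v,w)=0$, $h(u,v,w)=0$. [A2] (Competitively exclusive states) For some $u_i,v_i,w_i>0$ $(i=1,2,3)$ with $(\Lambda_1-\Lambda_2)^2+(\Lambda_1-\Lambda_3)^2+(\Lambda_2-\Lambda_3)^2\neq0$ for each of $\Lambda=u,v,w$, one has $f(u_1,0,0)=f(0,v_1,0)=f(0,0,w_1)=0$, $g(u_2,0,0)=g(0,v_2,0)=g(0,0,w_2)=0$, and $h(u_3,0,0)=h(0,v_3,0)=h(0,0,w_3)=0$. [A3] (Logistic-growth nonlinearity) For $u,v,w>0$: $f(u,v,w),g(u,v,w),h(u,v,w)<0$ when $u,v,w$ are sufficiently large, and $f(u,v,w),g(u,v,w),h(u,v,w)>0$ when $u,v,w$ are sufficiently small. [A4] (Covering pentahedron) There are constants $\bar u>\underline{u}>0$,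 $\bar v>\underline{v}>0$, $\bar w>\underline{w}>0$ such that the three surfaces $\mathcal{S}_f=\{(u,v,w): f(u,v,w)=0,\ u,v,w\ge0\}$, $\mathcal{S}_g=\{(u,v,w): g(u,v,w)=0,\ u,v,w\ge0\}$, $\mathcal{S}_h=\{(u,v,w): h(u,v,w)=0,\ u,v,w\ge0\}$ lie completely within the pentahedron $\mathcal{PH}$ enclosed by the $uv$-plane, the $uw$-plane, the $vw$-plane, and the planes $\bar{\mathcal{P}}=\{(u,v,w): \frac{u}{\bar u}+\frac{v}{\bar v}+\frac{w}{\bar w}=1,\ u,v,w\ge0\}$ and $\underline{\mathcal{P}}=\{(u,v,w): \frac{u}{\underline{u}}+\frac{v}{\underline{v}}+\frac{w}{\underline{w}}=1,\ u,v,w\ge0\}$; that is, $\mathcal{PH}=\{(u,v,w): u,v,w\ge0,\ \frac{u}{\underline{u}}+\frac{v}{\underline{v}}+\frac{w}{\underline{w}}\ge1,\ \frac{u}{\bar u}+\frac{v}{\bar v}+\frac{w}{\bar w}\le1\}$. *)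

theory Defs
  imports "HOL-Analysis.Analysis"
begin

type_synonym point3 = "real \<times> real \<times> real"

definition octant :: "point3 set" where
  "octant = {0..} \<times> {0..} \<times> {0..}"

definition unique_coexistence ::
    "(point3 \<Rightarrow> real) \<Rightarrow> (point3 \<Rightarrow> real) \<Rightarrow> (point3 \<Rightarrow> real) \<Rightarrow>
     real \<Rightarrow> real \<Rightarrow> real \<Rightarrow> bool" where
  "unique_coexistence f g h us vs ws \<longleftrightarrow>
     us > 0 \<and> vs > 0 \<and> ws > 0 \<and>
     f (us, vs, ws) = 0 \<and> g (us, vs, ws) = 0 \<and> h (us, vs, ws) = 0 \<and>
     (\<forall>u v w. u > 0 \<and> v > 0 \<and> w > 0 \<and>
        f (u, v, w) = 0 \<and> g (u, v, w) = 0 \<and> h (u, v, w) = 0 \<longrightarrow>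
        u = us \<and> v = vs \<and> w = ws)"

definition not_all_equal :: "real \<Rightarrow> real \<Rightarrow> real \<Rightarrow> bool" where
  "not_all_equal a b c \<longleftrightarrow> (a - b)\<^sup>2 + (a - c)\<^sup>2 + (b - c)\<^sup>2 \<noteq> 0"

definition exclusive_states ::
    "(point3 \<Rightarrow> real) \<Rightarrow> (point3 \<Rightarrow> real) \<Rightarrow> (point3 \<Rightarrow> real) \<Rightarrow>
     real \<Rightarrow> real \<Rightarrow> real \<Rightarrow> real \<Rightarrow> real \<Rightarrow> real \<Rightarrow> real \<Rightarrow> real \<Rightarrow> real \<Rightarrow> bool" where
  "exclusive_states f g h u1 u2 u3 v1 v2 v3 w1 w2 w3 \<longleftrightarrow>
     u1 > 0 \<and> u2 > 0 \<and> u3 > 0 \<and>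
     v1 > 0 \<and> v2 > 0 \<and> v3 > 0 \<and>
     w1 > 0 \<and> w2 > 0 \<and> w3 > 0 \<and>
     not_all_equal u1 u2 u3 \<and> not_all_equal v1 v2 v3 \<and> not_all_equal w1 w2 w3 \<and>
     f (u1, 0, 0) = 0 \<and> f (0, v1, 0) = 0 \<and> f (0, 0, w1) = 0 \<and>
     g (u2, 0, 0) = 0 \<and> g (0, v2, 0) = 0 \<and> g (0, 0, w2) = 0 \<and>
     h (u3, 0, 0) = 0 \<and> h (0, v3, 0) = 0 \<and> h (0, 0, w3) = 0"

text \<open>``Sufficiently large'' and ``sufficiently small'' constrain all three coordinates
  simultaneously, so no sign is prescribed on the coordinate planes.\<close>

definition logistic_growth :: "(point3 \<Rightarrow> real) \<Rightarrow> bool" where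
  "logistic_growth F \<longleftrightarrow>
     (\<exists>M>0. \<forall>u v w. u > M \<and> v > M \<and> w > M \<longrightarrow> F (u, v, w) < 0) \<and>
     (\<exists>\<epsilon>>0. \<forall>u v w. 0 < u \<and> u < \<epsilon> \<and> 0 < v \<and> v < \<epsilon> \<and> 0 < w \<and> w < \<epsilon> \<longrightarrow> F (u, v, w) > 0)"

definition zero_surface :: "(point3 \<Rightarrow> real) \<Rightarrow> point3 set" where
  "zero_surface F = {z \<in> octant. F z = 0}"

definition pentahedron ::
    "real \<Rightarrow> real \<Rightarrow> real \<Rightarrow> real \<Rightarrow> real \<Rightarrow> real \<Rightarrow> point3 set" where
  "pentahedron ul vl wl ub vb wb =
     {(u, v, w). u \<ge> 0 \<and> v \<ge> 0 \<and> w \<ge> 0 \<and>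
        u / ul + v / vl + w / wl \<ge> 1 \<and> u / ub + v / vb + w / wb \<le> 1}"

definition covering_pentahedron ::
    "(point3 \<Rightarrow> real) \<Rightarrow> (point3 \<Rightarrow> real) \<Rightarrow> (point3 \<Rightarrow> real) \<Rightarrow>
     real \<Rightarrow> real \<Rightarrow> real \<Rightarrow> real \<Rightarrow> real \<Rightarrow> real \<Rightarrow> bool" where
  "covering_pentahedron f g h ul vl wl ub vb wb \<longleftrightarrow>
     ub > ul \<and> ul > 0 \<and> vb > vl \<and> vl > 0 \<and> wb > wl \<and> wl > 0 \<and>
     zero_surface f \<subseteq> pentahedron ul vl wl ub vb wb \<and>
     zero_surface g \<subseteq> pentahedron ul vl wl ub vb wb \<and>
     zero_surface h \<subseteq> pentahedron ul vl wl ub vb wb"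

definition twice_differentiable :: "(real \<Rightarrow> real) \<Rightarrow> bool" where
  "twice_differentiable u \<longleftrightarrow>
     (\<forall>x. u differentiable (at x)) \<and> (\<forall>x. deriv u differentiable (at x))"

definition positive_bvp_solution ::
    "real \<Rightarrow> real \<Rightarrow> real \<Rightarrow> real \<Rightarrow>
     (point3 \<Rightarrow> real) \<Rightarrow> (point3 \<Rightarrow> real) \<Rightarrow> (point3 \<Rightarrow> real) \<Rightarrow> point3 \<Rightarrow> point3 \<Rightarrow>
     (real \<Rightarrow> real) \<Rightarrow> (real \<Rightarrow> real) \<Rightarrow> (real \<Rightarrow> real) \<Rightarrow> bool" where
  "positive_bvp_solution d1 d2 d3 \<theta> f g h em ep u v w \<longleftrightarrow>
     twice_differentiable u \<and> twice_differentiable v \<and> twice_differentiable w \<and>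
     (\<forall>x. u x > 0 \<and> v x > 0 \<and> w x > 0) \<and>
     (\<forall>x. d1 * deriv (deriv u) x + \<theta> * deriv u x + u x * f (u x, v x, w x) = 0) \<and>
     (\<forall>x. d2 * deriv (deriv v) x + \<theta> * deriv v x + v x * g (u x, v x, w x) = 0) \<and>
     (\<forall>x. d3 * deriv (deriv w) x + \<theta> * deriv w x + w x * h (u x, v x, w x) = 0) \<and>
     ((\<lambda>x. (u x, v x, w x)) \<longlongrightarrow> em) at_bot \<and>
     ((\<lambda>x. (u x, v x, w x)) \<longlongrightarrow> ep) at_top"

end

theory Submission
  imports Defs
begin

text \<open>Below the lower plane all three reaction terms are positive, above the upper plane all three
  are negative, so there every component satisfies \<open>d u'' + \<theta> u' \<le> 0\<close>, respectively \<open>\<ge> 0\<close>,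
  separately. By reflection let \<open>\<theta> \<ge> 0\<close>. Suppose \<open>p\<close> has a critical point \<open>z\<close> violating the lower
  bound \<open>m / D\<close>, where \<open>D\<close> is the ratio of the extreme diffusion rates. To the right of \<open>z\<close> each
  component lies below the solution of \<open>d y'' + \<theta> y' = 0\<close> with the same initial data at \<open>z\<close>; since
  these solutions are comparable for different \<open>d\<close> up to the factor \<open>D\<close>, and since the components are
  positive, \<open>p(x) \<le> D p(z) < m\<close>. So \<open>p\<close> never leaves the region to the right of \<open>z\<close>, which
  contradicts the limit at \<open>+\<infinity>\<close>. The upper bound is dual.\<close>

section \<open>Comparison with solutions of the constant coefficient equation\<close>

text \<open>The solution of \<open>d y'' + \<theta> y' = 0\<close>, \<open>y(0) = 0\<close>, \<open>y'(0) = 1\<close>.\<close>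

definition drift_profile :: "real \<Rightarrow> real \<Rightarrow> real \<Rightarrow> real" where
  "drift_profile \<theta> d s = (if \<theta> = 0 then s else d / \<theta> * (1 - exp (- (\<theta> * s / d))))"

lemma drift_profile_0 [simp]: "drift_profile \<theta> d 0 = 0"
  by (simp add: drift_profile_def)

lemma has_real_derivative_drift_profile:
  assumes "d > 0"
  shows "(drift_profile \<theta> d has_real_derivative exp (- (\<theta> * s / d))) (at s)"
proof (cases "\<theta> = 0")
  case True
  then show ?thesis by (auto simp: drift_profile_def [abs_def])
next
  case False
  then show ?thesis
    unfolding drift_profile_def [abs_def] using assms
    by (auto intro!: derivative_eq_intros)
qed

text \<open>Both profiles vanish at 0, and for \<open>s \<ge> 0\<close> the slope
  \<open>exp (- (\<theta> * s / d))\<close> increases with the diffusion rate.\<close>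

lemma drift_profile_mono:
  assumes "0 \<le> \<theta>" "0 < d" "d \<le> d'" "0 \<le> s"
  shows "drift_profile \<theta> d s \<le> drift_profile \<theta> d' s"
proof -
  have "drift_profile \<theta> d' 0 - drift_profile \<theta> d 0 \<le> drift_profile \<theta> d' s - drift_profile \<theta> d s"
  proof (rule DERIV_nonneg_imp_nondecreasing [OF \<open>0 \<le> s\<close>])
    fix r assume r: "0 \<le> r" "r \<le> s"
    have "((\<lambda>s. drift_profile \<theta> d' s - drift_profile \<theta> d s) has_real_derivative
        exp (- (\<theta> * r / d')) - exp (- (\<theta> * r / d))) (at r)"
      using assms by (intro DERIV_diff has_real_derivative_drift_profile) auto
    moreover have "\<theta> * r / d' \<le> \<theta> * r / d"
      using assms r by (intro divide_left_mono) auto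
    ultimately show "\<exists>y. ((\<lambda>s. drift_profile \<theta> d' s - drift_profile \<theta> d s) has_real_derivative y) (at r)
        \<and> 0 \<le> y"
      by force
  qed
  then show ?thesis by simp
qed

lemma drift_profile_nonneg:
  assumes "0 \<le> \<theta>" "0 < d" "0 \<le> s"
  shows "0 \<le> drift_profile \<theta> d s"
  using assms by (auto simp: drift_profile_def)

text \<open>Converse of monotonicity, up to the ratio of the rates: after division by
  \<open>d\<close> the profile is \<open>(1 - exp (- (\<theta> * s / d))) / \<theta>\<close>, which
  decreases in \<open>d\<close>.\<close>

lemma drift_profile_ratio:
  assumes "0 \<le> \<theta>" "0 < d" "d \<le> d'" "0 \<le> s"
  shows "drift_profile \<theta> d' s \<le> d' / d * drift_profile \<theta> d s"
proof (cases "\<theta> = 0")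
  case True
  have "d * s \<le> d' * s" using assms by (intro mult_right_mono) auto
  then show ?thesis using True assms by (simp add: drift_profile_def field_simps)
next
  case False
  have "\<theta> * s / d' \<le> \<theta> * s / d" using assms by (intro divide_left_mono) auto
  then have "1 - exp (- (\<theta> * s / d')) \<le> 1 - exp (- (\<theta> * s / d))" by simp
  then have "d' / \<theta> * (1 - exp (- (\<theta> * s / d'))) \<le> d' / \<theta> * (1 - exp (- (\<theta> * s / d)))"
    using assms by (intro mult_left_mono) auto
  then show ?thesis using False assms by (simp add: drift_profile_def)
qed

text \<open>The integrating factor \<open>exp (\<theta> * (y - z) / d)\<close> turns the
  differential inequality into monotonicity of its product with \<open>u'\<close>. This bounds the
  slope of \<open>u\<close> by that of the profile times \<open>u' z\<close>, and a second
  integration gives the claim.\<close>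

lemma supersolution_le_profile:
  fixes u u' u'' :: "real \<Rightarrow> real"
  assumes "0 < d" "z \<le> x"
    and u: "\<And>y. (u has_real_derivative u' y) (at y)"
    and u': "\<And>y. (u' has_real_derivative u'' y) (at y)"
    and super: "\<And>y. z \<le> y \<Longrightarrow> y \<le> x \<Longrightarrow> d * u'' y + \<theta> * u' y \<le> 0"
  shows "u x \<le> u z + drift_profile \<theta> d (x - z) * u' z"
proof -
  have slope: "u' y \<le> exp (- (\<theta> * (y - z) / d)) * u' z" if y: "z \<le> y" "y \<le> x" for y
  proof -
    have "exp (\<theta> * (y - z) / d) * u' y \<le> exp (\<theta> * (z - z) / d) * u' z"
    proof (rule DERIV_nonpos_imp_nonincreasing [OF y(1)])
      fix t assume t: "z \<le> t" "t \<le> y"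
      have "((\<lambda>y. exp (\<theta> * (y - z) / d) * u' y) has_real_derivative
          exp (\<theta> * (t - z) / d) / d * (d * u'' t + \<theta> * u' t)) (at t)"
        using \<open>0 < d\<close> by (auto intro!: derivative_eq_intros u' simp: field_simps)
      moreover have "exp (\<theta> * (t - z) / d) / d * (d * u'' t + \<theta> * u' t) \<le> 0"
        using super [of t] t y \<open>0 < d\<close> by (intro mult_nonneg_nonpos) auto
      ultimately show "\<exists>r. ((\<lambda>y. exp (\<theta> * (y - z) / d) * u' y) has_real_derivative r) (at t) \<and> r \<le> 0"
        by blast
    qed
    then show ?thesis by (simp add: exp_minus field_simps)
  qed
  have "u x - drift_profile \<theta> d (x - z) * u' z \<le> u z - drift_profile \<theta> d (z - z) * u' z"
  proof (rule DERIV_nonpos_imp_nonincreasing [OF \<open>z \<le> x\<close>])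
    fix t assume t: "z \<le> t" "t \<le> x"
    have "((\<lambda>x. drift_profile \<theta> d (x - z)) has_real_derivative exp (- (\<theta> * (t - z) / d)) * 1) (at t)"
      by (rule DERIV_chain2 [OF has_real_derivative_drift_profile [OF \<open>0 < d\<close>]])
        (auto intro!: derivative_eq_intros)
    then have "((\<lambda>x. u x - drift_profile \<theta> d (x - z) * u' z) has_real_derivative
        u' t - exp (- (\<theta> * (t - z) / d)) * 1 * u' z) (at t)"
      by (intro DERIV_diff u DERIV_cmult_right)
    then show "\<exists>r. ((\<lambda>x. u x - drift_profile \<theta> d (x - z) * u' z) has_real_derivative r) (at t) \<and> r \<le> 0"
      using slope [OF t] by force
  qed
  then show ?thesis by simp
qed

text \<open>Both growth bounds have the same coefficient of \<open>u' z\<close> for all diffusion rates \<open>d\<close> between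
  \<open>dm\<close> and \<open>dM\<close>, so that these terms cancel in a weighted sum at a critical point.\<close>

lemma supersolution_growth:
  fixes u u' u'' :: "real \<Rightarrow> real"
  assumes "0 \<le> \<theta>" "0 < dm" "dm \<le> d" "d \<le> dM" "z \<le> x"
    and u: "\<And>y. (u has_real_derivative u' y) (at y)"
    and u': "\<And>y. (u' has_real_derivative u'' y) (at y)"
    and super: "\<And>y. z \<le> y \<Longrightarrow> y \<le> x \<Longrightarrow> d * u'' y + \<theta> * u' y \<le> 0"
    and pos: "\<And>y. 0 < u y"
  shows "u x \<le> dM / dm * u z + dM / dm * drift_profile \<theta> dm (x - z) * u' z"
proof -
  define D K k where "D = dM / dm" and "K = drift_profile \<theta> dm (x - z)"
    and "k = drift_profile \<theta> d (x - z)"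
  have D: "1 \<le> D" using assms by (simp add: D_def)
  have K: "0 \<le> K" "K \<le> k"
    using assms by (auto simp: K_def k_def intro!: drift_profile_nonneg drift_profile_mono)
  have "k \<le> d / dm * K"
    unfolding k_def K_def using assms by (intro drift_profile_ratio) auto
  also have "\<dots> \<le> D * K"
    unfolding D_def using assms K by (intro mult_right_mono divide_right_mono) auto
  finally have kDK: "k \<le> D * K" .
  have le: "u x \<le> u z + k * u' z"
    unfolding k_def using assms by (intro supersolution_le_profile [of _ _ _ _ _ u'']) auto
  have "u z + k * u' z \<le> D * u z + D * K * u' z"
  proof (cases "0 \<le> u' z")
    case True
    have "k * u' z \<le> D * K * u' z" using kDK True by (rule mult_right_mono)
    moreover have "1 * u z \<le> D * u z" using D pos [of z] by (intro mult_right_mono) auto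
    ultimately show ?thesis by simp
  next
    \<comment> \<open>Positivity enters here: \<open>u z + k * u' z\<close> is at least
      \<open>u x > 0\<close>, so multiplying it by \<open>D \<ge> 1\<close> only enlarges it.
      Replacing \<open>k\<close> by the smaller \<open>K\<close> enlarges it again, because
      \<open>u' z\<close> is negative.\<close>
    case False
    have "0 \<le> (D - 1) * (u z + k * u' z)"
      using D le pos [of x] by (intro mult_nonneg_nonneg) auto
    moreover have "0 \<le> D * ((k - K) * - u' z)"
      using D K False by (intro mult_nonneg_nonneg) auto
    ultimately show ?thesis by (simp add: algebra_simps)
  qed
  with le show ?thesis by (simp add: D_def K_def)
qed

lemma subsolution_growth:
  fixes u u' u'' :: "real \<Rightarrow> real"
  assumes "0 \<le> \<theta>" "0 < dm" "dm \<le> d" "d \<le> dM" "z \<le> x"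
    and u: "\<And>y. (u has_real_derivative u' y) (at y)"
    and u': "\<And>y. (u' has_real_derivative u'' y) (at y)"
    and sub: "\<And>y. z \<le> y \<Longrightarrow> y \<le> x \<Longrightarrow> d * u'' y + \<theta> * u' y \<ge> 0"
    and pos: "\<And>y. 0 < u y"
  shows "dm / dM * u z + drift_profile \<theta> dm (x - z) * u' z \<le> u x"
proof -
  define E K k where "E = dm / dM" and "K = drift_profile \<theta> dm (x - z)"
    and "k = drift_profile \<theta> d (x - z)"
  have E: "0 < E" "E \<le> 1" using assms by (auto simp: E_def)
  have K: "0 \<le> K" "K \<le> k"
    using assms by (auto simp: K_def k_def intro!: drift_profile_nonneg drift_profile_mono)
  have "k \<le> d / dm * K"
    unfolding k_def K_def using assms by (intro drift_profile_ratio) auto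
  also have "\<dots> \<le> dM / dm * K"
    using assms K by (intro mult_right_mono divide_right_mono) auto
  finally have EkK: "E * k \<le> K" using assms by (simp add: E_def field_simps)
  \<comment> \<open>The negative of a subsolution is a supersolution, so the comparison is applied
    to \<open>- u\<close>.\<close>
  have "- u x \<le> - u z + k * - u' z"
    unfolding k_def
  proof (rule supersolution_le_profile [of _ _ _ _ _ "\<lambda>x. - u'' x"])
    show "d * - u'' y + \<theta> * - u' y \<le> 0" if "z \<le> y" "y \<le> x" for y
      using sub [OF that] by simp
  qed (use assms in \<open>auto intro: DERIV_minus u u'\<close>)
  then have le: "u z + k * u' z \<le> u x" by simp
  have "E * u z + K * u' z \<le> u x"
  proof (cases "0 \<le> u' z")
    case True
    have "K * u' z \<le> k * u' z" using K(2) True by (rule mult_right_mono)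
    moreover have "E * u z \<le> 1 * u z" using E pos [of z] by (intro mult_right_mono) auto
    ultimately show ?thesis using le by simp
  next
    \<comment> \<open>A negative slope makes \<open>K * u' z\<close> at most
      \<open>E * k * u' z\<close>, so the left side is at most \<open>E * u x\<close>; positivity of
      \<open>u x\<close> then removes the factor \<open>E \<le> 1\<close>.\<close>
    case False
    have "K * u' z \<le> E * k * u' z" using EkK False by (intro mult_right_mono_neg) auto
    then have "E * u z + K * u' z \<le> E * (u z + k * u' z)" by (simp add: algebra_simps)
    also have "\<dots> \<le> E * u x" using le E by (intro mult_left_mono) auto
    also have "\<dots> \<le> 1 * u x" using E pos [of x] by (intro mult_right_mono) auto
    finally show ?thesis by simp
  qed
  then show ?thesis by (simp add: E_def K_def)
qed

section \<open>Trapping to the right of a critical point\<close>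

text \<open>Outside a compact interval \<open>p\<close> stays above \<open>p x0\<close>, so its
  minimum over that interval is attained in the interior and is a critical point.\<close>

lemma critical_point_below_limits:
  fixes p p' :: "real \<Rightarrow> real"
  assumes p: "\<And>x. (p has_real_derivative p' x) (at x)"
    and bot: "(p \<longlongrightarrow> lm) at_bot" "p x0 < lm"
    and top: "(p \<longlongrightarrow> lp) at_top" "p x0 < lp"
  obtains z where "p z \<le> p x0" "p' z = 0"
proof -
  obtain a where a: "\<And>x. x \<le> a \<Longrightarrow> p x0 < p x"
    using order_tendstoD(1) [OF bot] by (auto simp: eventually_at_bot_linorder)
  obtain b where b: "\<And>x. b \<le> x \<Longrightarrow> p x0 < p x"
    using order_tendstoD(1) [OF top] by (auto simp: eventually_at_top_linorder)
  have ab: "a < x0" "x0 < b" using a [of x0] b [of x0] by force+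
  have "continuous_on {a..b} p"
    by (intro continuous_at_imp_continuous_on ballI DERIV_isCont [OF p])
  then obtain z where z: "z \<in> {a..b}" "\<And>y. y \<in> {a..b} \<Longrightarrow> p z \<le> p y"
    using continuous_attains_inf [of "{a..b}" p] ab by force
  have le: "p z \<le> p x0" using z(2) [of x0] ab by simp
  have "a < z" "z < b" using a [of z] b [of z] le by force+
  then have "p' z = 0"
    using z(2) by (intro DERIV_local_min [OF p, of "min (z - a) (b - z)"]) (auto simp: abs_less_iff)
  with le show ?thesis using that by blast
qed

text \<open>Before \<open>p\<close> first reaches \<open>m\<close> it is at most \<open>c\<close>.
  The gap \<open>c < m\<close> forbids a continuous function to jump from one level to the other, so
  \<open>m\<close> is never reached.\<close>

lemma continuous_bootstrap:
  fixes p :: "real \<Rightarrow> real"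
  assumes cont: "continuous_on UNIV p" and "p z < m" "c < m" "z \<le> x"
    and step: "\<And>x. z \<le> x \<Longrightarrow> (\<And>y. z \<le> y \<Longrightarrow> y \<le> x \<Longrightarrow> p y < m) \<Longrightarrow> p x \<le> c"
  shows "p x \<le> c"
proof -
  have "p y < m" if "z \<le> y" for y
  proof (rule ccontr)
    assume "\<not> p y < m"
    \<comment> \<open>The least element of this compact set is the first point at which
      \<open>p\<close> reaches \<open>m\<close>.\<close>
    define A where "A = {z..y} \<inter> p -` {m..}"
    have "closed (p -` {m..})"
      using cont by (intro continuous_closed_vimage) (auto simp: continuous_on_eq_continuous_at)
    then have "compact A" unfolding A_def by (intro compact_Int_closed) auto
    moreover have "A \<noteq> {}" using \<open>\<not> p y < m\<close> that by (auto simp: A_def)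
    ultimately obtain s where s: "s \<in> A" "\<And>t. t \<in> A \<Longrightarrow> s \<le> t"
      using compact_attains_inf by metis
    have below: "p t \<le> c" if "z \<le> t" "t < s" for t
    proof (rule step [OF that(1)])
      fix r assume "z \<le> r" "r \<le> t"
      then show "p r < m" using s(2) [of r] s(1) that by (force simp: A_def)
    qed
    have "z \<le> s" "m \<le> p s" using s by (auto simp: A_def)
    \<comment> \<open>For \<open>x = z\<close> the premise of \<open>step\<close> concerns only the
      point \<open>z\<close> itself.\<close>
    moreover have "p z \<le> c" using step [of z] \<open>p z < m\<close> by force
    ultimately obtain t where "z \<le> t" "t \<le> s" "p t = (c + m) / 2"
      using IVT' [of p z "(c + m) / 2" s] continuous_on_subset [OF cont] \<open>c < m\<close> by auto
    moreover have "t \<noteq> s" using calculation \<open>m \<le> p s\<close> \<open>c < m\<close> by auto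
    ultimately show False using below [of t] \<open>c < m\<close> by auto
  qed
  then show ?thesis using step [OF \<open>z \<le> x\<close>] by blast
qed

lemma weighted_sum_lower_bound_drift:
  fixes U U' U'' :: "'i \<Rightarrow> real \<Rightarrow> real" and c d :: "'i \<Rightarrow> real" and I :: "'i set"
  defines "p \<equiv> \<lambda>x. \<Sum>i\<in>I. c i * U i x"
  assumes "0 \<le> \<theta>" "0 < dm" "dm \<le> dM" and d: "\<And>i. i \<in> I \<Longrightarrow> dm \<le> d i \<and> d i \<le> dM"
    and c: "\<And>i. i \<in> I \<Longrightarrow> 0 < c i"
    and U: "\<And>i x. i \<in> I \<Longrightarrow> (U i has_real_derivative U' i x) (at x)"
    and U': "\<And>i x. i \<in> I \<Longrightarrow> (U' i has_real_derivative U'' i x) (at x)"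
    and pos: "\<And>i x. i \<in> I \<Longrightarrow> 0 < U i x"
    and super: "\<And>i x. i \<in> I \<Longrightarrow> p x < m \<Longrightarrow> d i * U'' i x + \<theta> * U' i x \<le> 0"
    and bot: "(p \<longlongrightarrow> lm) at_bot" "m \<le> lm"
    and top: "(p \<longlongrightarrow> lp) at_top" "m \<le> lp"
  shows "m * (dm / dM) \<le> p x"
proof (rule ccontr)
  assume "\<not> m * (dm / dM) \<le> p x"
  then have px: "dM / dm * p x < m" using assms(3,4) by (simp add: field_simps)
  have p0: "0 \<le> p x" for x
    unfolding p_def using c pos by (intro sum_nonneg mult_nonneg_nonneg) (auto intro: less_imp_le)
  \<comment> \<open>Since \<open>dM / dm \<ge> 1\<close> and \<open>p\<close> is nonnegative, the
    violated bound also puts \<open>p x\<close> itself below \<open>m\<close>, hence below both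
    limits.\<close>
  have "1 * p x \<le> dM / dm * p x" using assms(3,4) p0 [of x] by (intro mult_right_mono) auto
  then have "p x < m" using px by simp
  have Dp: "(p has_real_derivative (\<Sum>i\<in>I. c i * U' i x)) (at x)" for x
    unfolding p_def by (auto intro!: derivative_eq_intros U simp: mult.commute)
  obtain z where z: "p z \<le> p x" "(\<Sum>i\<in>I. c i * U' i z) = 0"
    using critical_point_below_limits [OF Dp bot(1) _ top(1)] bot(2) top(2) \<open>p x < m\<close>
    by (metis less_le_trans)
  have "dM / dm * p z \<le> dM / dm * p x" using z(1) assms(3,4) by (intro mult_left_mono) auto
  then have cm: "dM / dm * p z < m" using px by simp
  have "p y \<le> dM / dm * p z" if "z \<le> y" for y
  proof (rule continuous_bootstrap [of p z m])
    show "continuous_on UNIV p"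
      by (intro continuous_at_imp_continuous_on ballI DERIV_isCont [OF Dp])
    show "p z < m" using z(1) \<open>p x < m\<close> by simp
  next
    fix y assume y: "z \<le> y" "\<And>t. z \<le> t \<Longrightarrow> t \<le> y \<Longrightarrow> p t < m"
    define K where "K = drift_profile \<theta> dm (y - z)"
    have "p y \<le> (\<Sum>i\<in>I. c i * (dM / dm * U i z + dM / dm * K * U' i z))"
      unfolding p_def K_def
    proof (rule sum_mono)
      fix i assume i: "i \<in> I"
      show "c i * U i y \<le> c i * (dM / dm * U i z + dM / dm * drift_profile \<theta> dm (y - z) * U' i z)"
        using c [OF i] d [OF i] assms(2,3) y i
        by (intro mult_left_mono supersolution_growth [of _ _ "d i" _ _ _ _ _ "U'' i"])
          (auto intro: U U' pos super)
    qed
    \<comment> \<open>The coefficient of \<open>U' i z\<close> does not depend on \<open>i\<close>,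
      so these terms add up to a multiple of the derivative of \<open>p\<close> at \<open>z\<close>,
      which is 0.\<close>
    also have "\<dots> = dM / dm * p z + dM / dm * K * (\<Sum>i\<in>I. c i * U' i z)"
      by (simp add: p_def sum_distrib_left sum.distrib algebra_simps)
    finally show "p y \<le> dM / dm * p z" using z(2) by simp
  qed (use cm that in auto)
  \<comment> \<open>The trapping bound passes to the limit and yields \<open>lp < m\<close>, against
    \<open>m \<le> lp\<close>.\<close>
  then have "lp \<le> dM / dm * p z"
    by (intro tendsto_upperbound [OF top(1)]) (auto simp: eventually_at_top_linorder)
  then show False using cm top(2) by simp
qed

text \<open>Critical point and bootstrap are now used for \<open>- p\<close>: to the right of a high
  maximum, the subsolution bound keeps \<open>p\<close> above \<open>dm / dM\<close> times its value
  there, which still exceeds \<open>M\<close>.\<close>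

lemma weighted_sum_upper_bound_drift:
  fixes U U' U'' :: "'i \<Rightarrow> real \<Rightarrow> real" and c d :: "'i \<Rightarrow> real" and I :: "'i set"
  defines "p \<equiv> \<lambda>x. \<Sum>i\<in>I. c i * U i x"
  assumes "0 \<le> \<theta>" "0 < dm" "dm \<le> dM" and d: "\<And>i. i \<in> I \<Longrightarrow> dm \<le> d i \<and> d i \<le> dM"
    and c: "\<And>i. i \<in> I \<Longrightarrow> 0 < c i"
    and U: "\<And>i x. i \<in> I \<Longrightarrow> (U i has_real_derivative U' i x) (at x)"
    and U': "\<And>i x. i \<in> I \<Longrightarrow> (U' i has_real_derivative U'' i x) (at x)"
    and pos: "\<And>i x. i \<in> I \<Longrightarrow> 0 < U i x"
    and sub: "\<And>i x. i \<in> I \<Longrightarrow> M < p x \<Longrightarrow> d i * U'' i x + \<theta> * U' i x \<ge> 0"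
    and bot: "(p \<longlongrightarrow> lm) at_bot" "lm \<le> M"
    and top: "(p \<longlongrightarrow> lp) at_top" "lp \<le> M"
  shows "p x \<le> M * (dM / dm)"
proof (rule ccontr)
  assume "\<not> p x \<le> M * (dM / dm)"
  then have px: "M < dm / dM * p x" using assms(3,4) by (simp add: field_simps)
  have p0: "0 \<le> p x" for x
    unfolding p_def using c pos by (intro sum_nonneg mult_nonneg_nonneg) (auto intro: less_imp_le)
  have "dm / dM * p x \<le> 1 * p x" using assms(3,4) p0 [of x] by (intro mult_right_mono) auto
  then have "M < p x" using px by simp
  have Dp: "((\<lambda>x. - p x) has_real_derivative - (\<Sum>i\<in>I. c i * U' i x)) (at x)" for x
    unfolding p_def by (auto intro!: derivative_eq_intros U simp: mult.commute)
  obtain z where z: "- p z \<le> - p x" "- (\<Sum>i\<in>I. c i * U' i z) = 0"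
    using critical_point_below_limits [OF Dp tendsto_minus [OF bot(1)] _ tendsto_minus [OF top(1)]]
      bot(2) top(2) \<open>M < p x\<close>
    by (metis le_less_trans neg_less_iff_less)
  have "dm / dM * p x \<le> dm / dM * p z" using z(1) assms(3,4) by (intro mult_left_mono) auto
  then have cm: "M < dm / dM * p z" using px by simp
  have "- p y \<le> - (dm / dM * p z)" if "z \<le> y" for y
  proof (rule continuous_bootstrap [of "\<lambda>x. - p x" z "- M"])
    show "continuous_on UNIV (\<lambda>x. - p x)"
      by (intro continuous_at_imp_continuous_on ballI DERIV_isCont [OF Dp])
    show "- p z < - M" using z(1) \<open>M < p x\<close> by simp
  next
    fix y assume y: "z \<le> y" "\<And>t. z \<le> t \<Longrightarrow> t \<le> y \<Longrightarrow> - p t < - M"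
    define K where "K = drift_profile \<theta> dm (y - z)"
    have "dm / dM * p z + K * (\<Sum>i\<in>I. c i * U' i z)
        = (\<Sum>i\<in>I. c i * (dm / dM * U i z + K * U' i z))"
      by (simp add: p_def sum_distrib_left sum.distrib algebra_simps)
    also have "\<dots> \<le> p y"
      unfolding p_def K_def
    proof (rule sum_mono)
      fix i assume i: "i \<in> I"
      show "c i * (dm / dM * U i z + drift_profile \<theta> dm (y - z) * U' i z) \<le> c i * U i y"
        using c [OF i] d [OF i] assms(2,3) y i
        by (intro mult_left_mono subsolution_growth [of _ _ "d i" _ _ _ _ _ "U'' i"])
          (auto intro: U U' pos sub)
    qed
    finally show "- p y \<le> - (dm / dM * p z)" using z(2) by simp
  qed (use cm that in auto)
  then have "dm / dM * p z \<le> lp"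
    by (intro tendsto_lowerbound [OF top(1)]) (auto simp: eventually_at_top_linorder)
  then show False using cm top(2) by simp
qed

section \<open>Arbitrary drift by reflection\<close>

lemma has_real_derivative_reflect:
  fixes F F' :: "real \<Rightarrow> real"
  assumes "\<And>x. (F has_real_derivative F' x) (at x)"
  shows "((\<lambda>x. F (- x)) has_real_derivative - F' (- x)) (at x)"
  using assms [of "- x"] by (simp add: DERIV_mirror)

text \<open>The reflection of \<open>x\<close> to \<open>- x\<close> keeps second derivatives and
  negates first ones, so it replaces \<open>\<theta>\<close> by \<open>- \<theta>\<close> and
  exchanges the two limits.\<close>

lemma weighted_sum_lower_bound:
  fixes U U' U'' :: "'i \<Rightarrow> real \<Rightarrow> real" and c d :: "'i \<Rightarrow> real" and I :: "'i set"
  defines "p \<equiv> \<lambda>x. \<Sum>i\<in>I. c i * U i x"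
  assumes "0 < dm" "dm \<le> dM" and d: "\<And>i. i \<in> I \<Longrightarrow> dm \<le> d i \<and> d i \<le> dM"
    and c: "\<And>i. i \<in> I \<Longrightarrow> 0 < c i"
    and U: "\<And>i x. i \<in> I \<Longrightarrow> (U i has_real_derivative U' i x) (at x)"
    and U': "\<And>i x. i \<in> I \<Longrightarrow> (U' i has_real_derivative U'' i x) (at x)"
    and pos: "\<And>i x. i \<in> I \<Longrightarrow> 0 < U i x"
    and super: "\<And>i x. i \<in> I \<Longrightarrow> p x < m \<Longrightarrow> d i * U'' i x + \<theta> * U' i x \<le> 0"
    and bot: "(p \<longlongrightarrow> lm) at_bot" "m \<le> lm"
    and top: "(p \<longlongrightarrow> lp) at_top" "m \<le> lp"
  shows "m * (dm / dM) \<le> p x"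
proof (cases "0 \<le> \<theta>")
  case True
  then show ?thesis
    unfolding p_def
    using assms(2,3) d c U U' pos super bot top unfolding p_def
    by (intro weighted_sum_lower_bound_drift [of \<theta> dm dM I d c U U' U'' m lm lp]) auto
next
  case False
  \<comment> \<open>This is the bound for the reflected functions, taken at the point
    \<open>- x\<close>.\<close>
  have "m * (dm / dM) \<le> (\<Sum>i\<in>I. c i * U i (- (- x)))"
  proof (rule weighted_sum_lower_bound_drift
      [of "- \<theta>" dm dM I d c "\<lambda>i x. U i (- x)" "\<lambda>i x. - U' i (- x)" "\<lambda>i x. U'' i (- x)" m lp lm])
    show "((\<lambda>x. - U' i (- x)) has_real_derivative U'' i (- x)) (at x)" if "i \<in> I" for i x
      using DERIV_minus [OF has_real_derivative_reflect [of "U' i" "U'' i" x]] U' that by auto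
    show "((\<lambda>x. \<Sum>i\<in>I. c i * U i (- x)) \<longlongrightarrow> lp) at_bot"
      using top(1) unfolding p_def by (subst filterlim_at_bot_mirror) simp
    show "((\<lambda>x. \<Sum>i\<in>I. c i * U i (- x)) \<longlongrightarrow> lm) at_top"
      using bot(1) unfolding p_def by (subst filterlim_at_top_mirror) simp
    show "d i * U'' i (- x) + - \<theta> * - U' i (- x) \<le> 0"
      if "i \<in> I" "(\<Sum>i\<in>I. c i * U i (- x)) < m" for i x
      using super [of i "- x"] that by (simp add: p_def)
  qed (use False assms(2,3) d c pos bot(2) top(2) has_real_derivative_reflect U in auto)
  then show ?thesis by (simp add: p_def)
qed

lemma weighted_sum_upper_bound:
  fixes U U' U'' :: "'i \<Rightarrow> real \<Rightarrow> real" and c d :: "'i \<Rightarrow> real" and I :: "'i set"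
  defines "p \<equiv> \<lambda>x. \<Sum>i\<in>I. c i * U i x"
  assumes "0 < dm" "dm \<le> dM" and d: "\<And>i. i \<in> I \<Longrightarrow> dm \<le> d i \<and> d i \<le> dM"
    and c: "\<And>i. i \<in> I \<Longrightarrow> 0 < c i"
    and U: "\<And>i x. i \<in> I \<Longrightarrow> (U i has_real_derivative U' i x) (at x)"
    and U': "\<And>i x. i \<in> I \<Longrightarrow> (U' i has_real_derivative U'' i x) (at x)"
    and pos: "\<And>i x. i \<in> I \<Longrightarrow> 0 < U i x"
    and sub: "\<And>i x. i \<in> I \<Longrightarrow> M < p x \<Longrightarrow> d i * U'' i x + \<theta> * U' i x \<ge> 0"
    and bot: "(p \<longlongrightarrow> lm) at_bot" "lm \<le> M"
    and top: "(p \<longlongrightarrow> lp) at_top" "lp \<le> M"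
  shows "p x \<le> M * (dM / dm)"
proof (cases "0 \<le> \<theta>")
  case True
  then show ?thesis
    unfolding p_def
    using assms(2,3) d c U U' pos sub bot top unfolding p_def
    by (intro weighted_sum_upper_bound_drift [of \<theta> dm dM I d c U U' U'' M lm lp]) auto
next
  case False
  have "(\<Sum>i\<in>I. c i * U i (- (- x))) \<le> M * (dM / dm)"
  proof (rule weighted_sum_upper_bound_drift
      [of "- \<theta>" dm dM I d c "\<lambda>i x. U i (- x)" "\<lambda>i x. - U' i (- x)" "\<lambda>i x. U'' i (- x)" M lp lm])
    show "((\<lambda>x. - U' i (- x)) has_real_derivative U'' i (- x)) (at x)" if "i \<in> I" for i x
      using DERIV_minus [OF has_real_derivative_reflect [of "U' i" "U'' i" x]] U' that by auto
    show "((\<lambda>x. \<Sum>i\<in>I. c i * U i (- x)) \<longlongrightarrow> lp) at_bot"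
      using top(1) unfolding p_def by (subst filterlim_at_bot_mirror) simp
    show "((\<lambda>x. \<Sum>i\<in>I. c i * U i (- x)) \<longlongrightarrow> lm) at_top"
      using bot(1) unfolding p_def by (subst filterlim_at_top_mirror) simp
    show "d i * U'' i (- x) + - \<theta> * - U' i (- x) \<ge> 0"
      if "i \<in> I" "M < (\<Sum>i\<in>I. c i * U i (- x))" for i x
      using sub [of i "- x"] that by (simp add: p_def)
  qed (use False assms(2,3) d c pos bot(2) top(2) has_real_derivative_reflect U in auto)
  then show ?thesis by (simp add: p_def)
qed

section \<open>Signs of the reaction terms outside the pentahedron\<close>

lemma convex_octant: "convex octant"
  unfolding octant_def by (intro convex_Times) auto

text \<open>In inner product form the regions on either side of a plane are visibly half-spaces,
  hence convex.\<close>

lemma plane_eq_inner: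
  fixes u v w a b c :: real
  shows "u / a + v / b + w / c = (1 / a, 1 / b, 1 / c) \<bullet> (u, v, w)"
  by (simp add: inner_real_def)

lemma zero_between_signs:
  fixes F :: "point3 \<Rightarrow> real"
  assumes "continuous_on A F" "convex A" "a \<in> A" "b \<in> A" "F a \<le> 0" "0 \<le> F b"
  obtains z where "z \<in> A" "F z = 0"
proof -
  have "connected (F ` A)"
    using assms by (intro connected_continuous_image convex_connected)
  then have "{F a..F b} \<subseteq> F ` A" using assms by (intro connected_contains_Icc) auto
  then show ?thesis using assms that by force
qed

text \<open>The part of the octant below the lower plane is convex and, by [A4], free of zeros of
  \<open>F\<close>. Hence \<open>F\<close> has a single sign there, and [A3] fixes it near the
  origin.\<close>

lemma positive_below_pentahedron:
  assumes cont: "continuous_on octant F" and log: "logistic_growth F"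
    and zeros: "zero_surface F \<subseteq> pentahedron ul vl wl ub vb wb"
    and l: "0 < ul" "0 < vl" "0 < wl"
    and z: "0 \<le> u" "0 \<le> v" "0 \<le> w" "u / ul + v / vl + w / wl < 1"
  shows "0 < F (u, v, w)"
proof (rule ccontr)
  define A where "A = octant \<inter> {z. (1 / ul, 1 / vl, 1 / wl) \<bullet> z < 1}"
  assume neg: "\<not> 0 < F (u, v, w)"
  obtain e where e: "0 < e"
    "\<And>u v w. 0 < u \<Longrightarrow> u < e \<Longrightarrow> 0 < v \<Longrightarrow> v < e \<Longrightarrow> 0 < w \<Longrightarrow> w < e \<Longrightarrow> 0 < F (u, v, w)"
    using log unfolding logistic_growth_def by blast
  \<comment> \<open>The division by 4 makes each of the three quotients at most 1/4, so the diagonal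
    point lies below the plane; it also gives \<open>t < e\<close>.\<close>
  define t where "t = min e (min ul (min vl wl)) / 4"
  have t: "0 < t" "t < e" "t \<le> ul / 4" "t \<le> vl / 4" "t \<le> wl / 4"
    using e l by (auto simp: t_def)
  have "t / ul \<le> 1 / 4" "t / vl \<le> 1 / 4" "t / wl \<le> 1 / 4" using t l by (auto simp: field_simps)
  then have "t / ul + t / vl + t / wl < 1" by linarith
  then have "(t, t, t) \<in> A" "(u, v, w) \<in> A"
    using t z unfolding A_def octant_def plane_eq_inner by auto
  moreover have "0 \<le> F (t, t, t)" using e(2) t by (simp add: less_imp_le)
  moreover have "convex A"
    unfolding A_def by (intro convex_Int convex_octant convex_halfspace_lt)
  moreover have "continuous_on A F" using cont by (rule continuous_on_subset) (auto simp: A_def)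
  ultimately obtain y where y: "y \<in> A" "F y = 0"
    using zero_between_signs [of A F "(u, v, w)" "(t, t, t)"] neg by auto
  then have "y \<in> pentahedron ul vl wl ub vb wb"
    using zeros by (auto simp: zero_surface_def A_def)
  with y(1) show False unfolding A_def pentahedron_def plane_eq_inner by force
qed

text \<open>Same argument on the convex region above the upper plane, with the sign taken from a
  remote diagonal point.\<close>

lemma negative_above_pentahedron:
  assumes cont: "continuous_on octant F" and log: "logistic_growth F"
    and zeros: "zero_surface F \<subseteq> pentahedron ul vl wl ub vb wb"
    and b: "0 < ub" "0 < vb" "0 < wb"
    and z: "0 \<le> u" "0 \<le> v" "0 \<le> w" "1 < u / ub + v / vb + w / wb"
  shows "F (u, v, w) < 0"
proof (rule ccontr)
  define A where "A = octant \<inter> {z. (1 / ub, 1 / vb, 1 / wb) \<bullet> z > 1}"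
  assume neg: "\<not> F (u, v, w) < 0"
  obtain m where m: "0 < m" "\<And>u v w. m < u \<Longrightarrow> m < v \<Longrightarrow> m < w \<Longrightarrow> F (u, v, w) < 0"
    using log unfolding logistic_growth_def by blast
  \<comment> \<open>Adding \<open>ub\<close> makes the first quotient alone exceed 1, while
    \<open>t\<close> stays beyond the threshold \<open>m\<close>.\<close>
  define t where "t = m + ub"
  have t: "m < t" "ub < t" "0 < t" using m b by (auto simp: t_def)
  have "1 < t / ub" "0 < t / vb" "0 < t / wb" using t b by auto
  then have "1 < t / ub + t / vb + t / wb" by linarith
  then have "(t, t, t) \<in> A" "(u, v, w) \<in> A"
    using t z unfolding A_def octant_def plane_eq_inner by auto
  moreover have "F (t, t, t) \<le> 0" using m(2) t by (simp add: less_imp_le)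
  moreover have "convex A"
    unfolding A_def by (intro convex_Int convex_octant convex_halfspace_gt)
  moreover have "continuous_on A F" using cont by (rule continuous_on_subset) (auto simp: A_def)
  ultimately obtain y where y: "y \<in> A" "F y = 0"
    using zero_between_signs [of A F "(t, t, t)" "(u, v, w)"] neg by auto
  then have "y \<in> pentahedron ul vl wl ub vb wb"
    using zeros by (auto simp: zero_surface_def A_def)
  with y(1) show False unfolding A_def pentahedron_def plane_eq_inner by force
qed

text \<open>Converts a small weighted sum into a position below the plane: a value under a positive
  minimum forces \<open>u / a + v / b + w / c < 1\<close>.\<close>

lemma Min_mult_plane_le:
  fixes u v w a b c :: real
  assumes "0 \<le> u" "0 \<le> v" "0 \<le> w" "0 < a" "0 < b" "0 < c"
  shows "Min {\<alpha> * a, \<beta> * b, \<gamma> * c} * (u / a + v / b + w / c) \<le> \<alpha> * u + \<beta> * v + \<gamma> * w"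
proof -
  let ?m = "Min {\<alpha> * a, \<beta> * b, \<gamma> * c}"
  have "?m * (u / a) \<le> \<alpha> * a * (u / a)" "?m * (v / b) \<le> \<beta> * b * (v / b)"
    "?m * (w / c) \<le> \<gamma> * c * (w / c)"
    using assms by (intro mult_right_mono; simp)+
  then show ?thesis using assms by (simp add: distrib_left)
qed

text \<open>Dually, a weighted sum above a positive maximum forces the point above the
  plane.\<close>

lemma le_Max_mult_plane:
  fixes u v w a b c :: real
  assumes "0 \<le> u" "0 \<le> v" "0 \<le> w" "0 < a" "0 < b" "0 < c"
  shows "\<alpha> * u + \<beta> * v + \<gamma> * w \<le> Max {\<alpha> * a, \<beta> * b, \<gamma> * c} * (u / a + v / b + w / c)"
proof -
  let ?m = "Max {\<alpha> * a, \<beta> * b, \<gamma> * c}"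
  have "\<alpha> * a * (u / a) \<le> ?m * (u / a)" "\<beta> * b * (v / b) \<le> ?m * (v / b)"
    "\<gamma> * c * (w / c) \<le> ?m * (w / c)"
    using assms by (intro mult_right_mono; simp)+
  then show ?thesis using assms by (simp add: distrib_left)
qed

section \<open>Bounds for the traveling wave\<close>

lemma twice_differentiableD:
  assumes "twice_differentiable u"
  shows "(u has_real_derivative deriv u x) (at x)"
    and "(deriv u has_real_derivative deriv (deriv u) x) (at x)"
  using assms unfolding twice_differentiable_def
  by (auto simp: DERIV_deriv_iff_real_differentiable)

theorem theorem2p1:
  fixes d1 d2 d3 \<theta> :: real
    and f g h :: "real \<times> real \<times> real \<Rightarrow> real"
    and us vs ws :: real
    and u1 u2 u3 v1 v2 v3 w1 w2 w3 :: real
    and ul vl wl ub vb wb :: real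
    and em ep :: "real \<times> real \<times> real"
    and u v w :: "real \<Rightarrow> real"
    and \<alpha> \<beta> \<gamma> :: real
  assumes d: "d1 > 0" "d2 > 0" "d3 > 0"
    and cont: "continuous_on octant f" "continuous_on octant g" "continuous_on octant h"
    and A1: "unique_coexistence f g h us vs ws"
    and A2: "exclusive_states f g h u1 u2 u3 v1 v2 v3 w1 w2 w3"
    and A3: "logistic_growth f" "logistic_growth g" "logistic_growth h"
    and A4: "covering_pentahedron f g h ul vl wl ub vb wb"
    and em: "em \<in> {(0, 0, 0), (u1, 0, 0), (0, v2, 0), (0, 0, w3), (us, vs, ws)}"
    and ep: "ep \<in> {(0, 0, 0), (u1, 0, 0), (0, v2, 0), (0, 0, w3), (us, vs, ws)}"
    and sol: "positive_bvp_solution d1 d2 d3 \<theta> f g h em ep u v w"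
    and weights: "\<alpha> > 0" "\<beta> > 0" "\<gamma> > 0"
  defines "p \<equiv> \<lambda>x. \<alpha> * u x + \<beta> * v x + \<gamma> * w x"
    and "chi \<equiv> (if em \<noteq> (0, 0, 0) \<and> ep \<noteq> (0, 0, 0) then (1::real) else 0)"
  shows "\<forall>x. Min {\<alpha> * ul, \<beta> * vl, \<gamma> * wl} * (Min {d1, d2, d3} / Max {d1, d2, d3}) * chi \<le> p x
           \<and> p x \<le> Max {\<alpha> * ub, \<beta> * vb, \<gamma> * wb} * (Max {d1, d2, d3} / Min {d1, d2, d3})"
proof -
  define m M dm dM where "m = Min {\<alpha> * ul, \<beta> * vl, \<gamma> * wl}"
    and "M = Max {\<alpha> * ub, \<beta> * vb, \<gamma> * wb}"
    and "dm = Min {d1, d2, d3}" and "dM = Max {d1, d2, d3}"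
  have l: "0 < ul" "0 < vl" "0 < wl" and b: "0 < ub" "0 < vb" "0 < wb"
    and zeros: "zero_surface f \<subseteq> pentahedron ul vl wl ub vb wb"
      "zero_surface g \<subseteq> pentahedron ul vl wl ub vb wb"
      "zero_surface h \<subseteq> pentahedron ul vl wl ub vb wb"
    using A4 unfolding covering_pentahedron_def by auto
  have mpos: "0 < m" and Mpos: "0 < M" using l b weights by (auto simp: m_def M_def less_max_iff_disj)
  have dmM: "0 < dm" "dm \<le> dM" using d by (auto simp: dm_def dM_def)
  have tw: "twice_differentiable u" "twice_differentiable v" "twice_differentiable w"
    and pos: "0 < u x" "0 < v x" "0 < w x"
    and eqs: "d1 * deriv (deriv u) x + \<theta> * deriv u x + u x * f (u x, v x, w x) = 0"
      "d2 * deriv (deriv v) x + \<theta> * deriv v x + v x * g (u x, v x, w x) = 0"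
      "d3 * deriv (deriv w) x + \<theta> * deriv w x + w x * h (u x, v x, w x) = 0"
    and lim: "((\<lambda>x. (u x, v x, w x)) \<longlongrightarrow> em) at_bot" "((\<lambda>x. (u x, v x, w x)) \<longlongrightarrow> ep) at_top" for x
    using sol unfolding positive_bvp_solution_def by auto
  \<comment> \<open>The values of this linear form at the boundary states are the limits of
    \<open>p\<close>.\<close>
  define P :: "point3 \<Rightarrow> real" where "P = (\<lambda>(u, v, w). \<alpha> * u + \<beta> * v + \<gamma> * w)"
  have P_lim: "(p \<longlongrightarrow> P e) F" if "((\<lambda>x. (u x, v x, w x)) \<longlongrightarrow> e) F" for e F
    using tendsto_fst [OF that] tendsto_fst [OF tendsto_snd [OF that]]
      tendsto_snd [OF tendsto_snd [OF that]]
    by (cases e) (auto simp: p_def P_def intro!: tendsto_intros)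
  \<comment> \<open>Every nonzero boundary state is a zero of one of the reaction terms, so [A4]
    places it in the pentahedron.\<close>
  have in_penta: "e \<in> pentahedron ul vl wl ub vb wb"
    if "e \<in> {(u1, 0, 0), (0, v2, 0), (0, 0, w3), (us, vs, ws)}" for e
  proof -
    have "0 < u1" "0 < v2" "0 < w3" "f (u1, 0, 0) = 0" "g (0, v2, 0) = 0" "h (0, 0, w3) = 0"
      "0 < us" "0 < vs" "0 < ws" "f (us, vs, ws) = 0"
      using A1 A2 unfolding unique_coexistence_def exclusive_states_def by blast+
    then have "(u1, 0, 0) \<in> zero_surface f" "(0, v2, 0) \<in> zero_surface g"
      "(0, 0, w3) \<in> zero_surface h" "(us, vs, ws) \<in> zero_surface f"
      unfolding zero_surface_def octant_def by auto
    then show ?thesis using that zeros by blast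
  qed
  have P_penta: "m \<le> P e" "P e \<le> M" if "e \<in> pentahedron ul vl wl ub vb wb" for e
  proof -
    obtain a b' c where e: "e = (a, b', c)" by (cases e)
    have nn: "0 \<le> a" "0 \<le> b'" "0 \<le> c" and ge: "1 \<le> a / ul + b' / vl + c / wl"
      and le: "a / ub + b' / vb + c / wb \<le> 1"
      using that by (auto simp: e pentahedron_def)
    have "m * 1 \<le> m * (a / ul + b' / vl + c / wl)" using ge mpos by (intro mult_left_mono) auto
    then show "m \<le> P e"
      using Min_mult_plane_le [OF nn l, of \<alpha> \<beta> \<gamma>] by (simp add: P_def e m_def)
    have "M * (a / ub + b' / vb + c / wb) \<le> M * 1" using le Mpos by (intro mult_left_mono) auto
    then show "P e \<le> M"
      using le_Max_mult_plane [OF nn b, of \<alpha> \<beta> \<gamma>] by (simp add: P_def e M_def)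
  qed
  \<comment> \<open>The origin lies outside the pentahedron, but \<open>P\<close> vanishes there, so
    the upper estimate covers it as well.\<close>
  have P_le: "P e \<le> M" if "e \<in> {(0, 0, 0), (u1, 0, 0), (0, v2, 0), (0, 0, w3), (us, vs, ws)}" for e
    using that P_penta(2) [OF in_penta [of e]] Mpos by (cases "e = (0, 0, 0)") (auto simp: P_def)

  \<comment> \<open>The three species become list entries indexed by 0, 1, 2, so that the bounds for
    weighted sums apply.\<close>
  define I where "I = {0, 1, 2 :: nat}"
  define D C where "D = (!) [d1, d2, d3]" and "C = (!) [\<alpha>, \<beta>, \<gamma>]"
  define U where "U = (!) [u, v, w]"
  have p_eq: "p = (\<lambda>x. \<Sum>i\<in>I. C i * U i x)"
    by (auto simp: p_def I_def C_def U_def fun_eq_iff)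
  have D_bounds: "dm \<le> D i \<and> D i \<le> dM" if "i \<in> I" for i
    using that by (auto simp: I_def D_def dm_def dM_def)
  have C_pos: "0 < C i" if "i \<in> I" for i using that weights by (auto simp: I_def C_def)
  have U_pos: "0 < U i x" if "i \<in> I" for i x using that pos by (auto simp: I_def U_def)
  have U1: "(U i has_real_derivative deriv (U i) x) (at x)" if "i \<in> I" for i x
    using that twice_differentiableD(1) tw by (auto simp: I_def U_def)
  have U2: "(deriv (U i) has_real_derivative deriv (deriv (U i)) x) (at x)" if "i \<in> I" for i x
    using that twice_differentiableD(2) tw by (auto simp: I_def U_def)

  have lower: "m * (dm / dM) \<le> p x" if ne: "em \<noteq> (0, 0, 0)" "ep \<noteq> (0, 0, 0)" for x
    unfolding p_eq
  proof (rule weighted_sum_lower_bound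
      [of dm dM I D C U "\<lambda>i. deriv (U i)" "\<lambda>i. deriv (deriv (U i))" m \<theta> "P em" "P ep"])
    fix i y assume i: "i \<in> I" and "(\<Sum>i\<in>I. C i * U i y) < m"
    then have "p y < m" by (simp add: p_eq)
    moreover have "m * (u y / ul + v y / vl + w y / wl) \<le> p y"
      unfolding p_def m_def using pos by (intro Min_mult_plane_le l) (auto intro: less_imp_le)
    ultimately have "m * (u y / ul + v y / vl + w y / wl) < m * 1" by simp
    then have "u y / ul + v y / vl + w y / wl < 1" using mpos by simp
    then have "0 < f (u y, v y, w y)" "0 < g (u y, v y, w y)" "0 < h (u y, v y, w y)"
      using positive_below_pentahedron cont A3 zeros l pos by (meson less_imp_le)+
    then have "0 < u y * f (u y, v y, w y)" "0 < v y * g (u y, v y, w y)" "0 < w y * h (u y, v y, w y)"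
      using pos by auto
    \<comment> \<open>By the equations, each differential expression is the negative of its reaction
      product, which is positive here.\<close>
    then show "D i * deriv (deriv (U i)) y + \<theta> * deriv (U i) y \<le> 0"
      using eqs [of y] i by (auto simp: I_def D_def U_def)
  next
    show "m \<le> P em" "m \<le> P ep" using P_penta(1) in_penta em ep ne by auto
  qed (use dmM D_bounds C_pos U_pos U1 U2 P_lim lim in \<open>auto simp: p_eq\<close>)

  have upper: "p x \<le> M * (dM / dm)" for x
    unfolding p_eq
  proof (rule weighted_sum_upper_bound
      [of dm dM I D C U "\<lambda>i. deriv (U i)" "\<lambda>i. deriv (deriv (U i))" M \<theta> "P em" "P ep"])
    fix i y assume i: "i \<in> I" and "M < (\<Sum>i\<in>I. C i * U i y)"
    then have "M < p y" by (simp add: p_eq)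
    moreover have "p y \<le> M * (u y / ub + v y / vb + w y / wb)"
      unfolding p_def M_def using pos by (intro le_Max_mult_plane b) (auto intro: less_imp_le)
    ultimately have "M * 1 < M * (u y / ub + v y / vb + w y / wb)" by simp
    then have "1 < u y / ub + v y / vb + w y / wb" using Mpos by simp
    then have "f (u y, v y, w y) < 0" "g (u y, v y, w y) < 0" "h (u y, v y, w y) < 0"
      using negative_above_pentahedron cont A3 zeros b pos by (meson less_imp_le)+
    then have "u y * f (u y, v y, w y) < 0" "v y * g (u y, v y, w y) < 0" "w y * h (u y, v y, w y) < 0"
      using pos by (auto intro: mult_pos_neg)
    then show "0 \<le> D i * deriv (deriv (U i)) y + \<theta> * deriv (U i) y"
      using eqs [of y] i by (auto simp: I_def D_def U_def)
  next
    show "P em \<le> M" "P ep \<le> M" using P_le em ep by auto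
  qed (use dmM D_bounds C_pos U_pos U1 U2 P_lim lim in \<open>auto simp: p_eq\<close>)

  have "m * (dm / dM) * chi \<le> p x" for x
  proof (cases "em \<noteq> (0, 0, 0) \<and> ep \<noteq> (0, 0, 0)")
    case True
    then show ?thesis using lower by (simp add: chi_def)
  next
    \<comment> \<open>With the origin as a limit, the claim reduces to nonnegativity of
      \<open>p\<close>.\<close>
    case False
    then have "chi = 0" by (auto simp: chi_def)
    then show ?thesis using pos [of x] weights by (simp add: p_def add_nonneg_nonneg)
  qed
  with upper show ?thesis unfolding m_def M_def dm_def dM_def by blast
qed

end
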